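(* Let $\mathbb{F}$ be a finite field, let $s,\ell\ge 1$ be integers, and let $I$ be an ideal of $R=\mathbb{F}[x,y]/\langle x^s-1,\,y^{\ell}-1\rangle$. For $j=0,\dots,\ell-1$ let $I_j$ be the $j$-th coefficient ideal of $I$ in $S=\mathbb{F}[x]/\langle x^s-1\rangle$, let $p_j^j(x)$ be its monic generator dividing $x^s-1$, let $a_j=\deg(p_j^j(x))$, and let $\mathfrak{p}_j(x,y)\in I$ be an element of the form $\mathfrak{p}_j(x,y)=\sum_{i=j}^{\ell-1}p_i^j(x)y^i$ with $p_i^j(x)\in S$ whose coefficient of $y^j$ is $p_j^j(x)$ (all as defined in the context), so that $I$ is generated by $\{\mathfrak{p}_0(x,y),\dots,\mathfrak{p}_{\ell-1}(x,y)\}$. Then the set $$\{\,x^k\,\mathfrak{p}_j(x,y)\;:\;0\le j\le \ell-1,\ 0\le k\le s-a_j-1\,\}$$ forms an $\mathbb{F}$-basis for $I$.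
   Context: Write $S=\mathbb{F}[x]/\langle x^s-1\rangle$ and $R=\mathbb{F}[x,y]/\langle x^s-1,y^\ell-1\rangle\cong S[y]/\langle y^\ell-1\rangle$. Cosets are denoted by their representatives. Every element of $R$ can be written uniquely as $\sum_{i=0}^{\ell-1}f_i(x)y^i$ with $f_i(x)\in S$. For an ideal $I$ of $R$ and $0\le j\le \ell-1$, the $j$-th coefficient ideal is $$I_j=\Big\{g_j(x)\in S:\ \text{there exists } g(x,y)\in I \text{ such that } g(x,y)=\sum_{i=j}^{\ell-1}g_i(x)y^i \text{ with } g_i(x)\in S\Big\}.$$ Each $I_j$ is an ideal of the principal ideal ring $S$, and $p_j^j(x)\in\mathbb{F}[x]$ denotes the unique monic divisor of $x^s-1$ in $\mathbb{F}[x]$ such that $I_j=\langle p_j^j(x)\rangle$ in $S$ (so $p_j^j(x)=x^s-1$, of degree $s$, when $I_j=0$). The degree $\deg(p_j^j(x))$ is the degree as a polynomial in $\mathbb{F}[x]$. Since $p_j^j(x)\in I_j$, there exists an element $\mathfrak{p}_j(x,y)\in I$ of the form $\mathfrak{p}_j(x,y)=\sum_{i=j}^{\ell-1}p_i^j(x)y^i$, with $p_i^j(x)\in S$ and with coefficient of $y^j$ equal to (the class of) $p_j^j(x)$; one such element is fixed for each $j$. Ideals of $R$ correspond to two-dimensional cyclic codes of length $s\ell$ over $\mathbb{F}$. *)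

theory Defs
  imports
    "HOL-Computational_Algebra.Polynomial"
    "HOL-Algebra.QuotRing"
    "HOL-Algebra.Algebraic_Closure_Type"
    "Jordan_Normal_Form.Missing_VectorSpace"
begin

text \<open>
  The type \<open>'a poly\<close> is \<open>F[x]\<close> and \<open>'a poly poly\<close> is \<open>F[x][y] = F[x,y]\<close>: the inner
  variable is \<open>x\<close>, the outer one is \<open>y\<close>.
\<close>

definition S_modulus :: "nat \<Rightarrow> 'a::field poly set" where
  "S_modulus s = Idl\<^bsub>ring_of_type_algebra\<^esub> {monom 1 s - 1}"

definition S_ring :: "nat \<Rightarrow> 'a::field poly set ring" where
  "S_ring s = ring_of_type_algebra Quot S_modulus s"

definition S_class :: "nat \<Rightarrow> 'a::field poly \<Rightarrow> 'a poly set" where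
  "S_class s f = S_modulus s +>\<^bsub>ring_of_type_algebra\<^esub> f"

definition R_modulus :: "nat \<Rightarrow> nat \<Rightarrow> 'a::field poly poly set" where
  "R_modulus s l = Idl\<^bsub>ring_of_type_algebra\<^esub> {[:monom 1 s - 1:], monom 1 l - 1}"

definition R_ring :: "nat \<Rightarrow> nat \<Rightarrow> 'a::field poly poly set ring" where
  "R_ring s l = ring_of_type_algebra Quot R_modulus s l"

definition R_class :: "nat \<Rightarrow> nat \<Rightarrow> 'a::field poly poly \<Rightarrow> 'a poly poly set" where
  "R_class s l h = R_modulus s l +>\<^bsub>ring_of_type_algebra\<^esub> h"

text \<open>
  The element \<open>g\<^sub>j(x) y\<^sup>j + \<dots> + g\<^bsub>l-1\<^esub>(x) y\<^bsup>l-1\<^esup>\<close> of \<open>R\<close>. The coefficients, which live in \<open>S\<close>, are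
  given by representatives in \<open>F[x]\<close>; the result depends only on their classes in \<open>S\<close>.
\<close>

definition R_expansion :: "nat \<Rightarrow> nat \<Rightarrow> nat \<Rightarrow> (nat \<Rightarrow> 'a::field poly) \<Rightarrow> 'a poly poly set" where
  "R_expansion s l j g = R_class s l (\<Sum>i=j..<l. monom (g i) i)"

definition coeff_ideal :: "nat \<Rightarrow> nat \<Rightarrow> 'a::field poly poly set set \<Rightarrow> nat \<Rightarrow> 'a poly set set" where
  "coeff_ideal s l I j = {S_class s (g j) | g. R_expansion s l j g \<in> I}"

text \<open>For the zero ideal the generator is \<open>x\<^sup>s - 1\<close> itself, of degree \<open>s\<close>.\<close>

definition is_monic_generator :: "nat \<Rightarrow> 'a::field poly set set \<Rightarrow> 'a poly \<Rightarrow> bool" where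
  "is_monic_generator s K p \<longleftrightarrow>
     lead_coeff p = 1 \<and> p dvd monom 1 s - 1 \<and> K = PIdl\<^bsub>S_ring s\<^esub> (S_class s p)"

text \<open>\<open>R\<close> as a vector space over \<open>F\<close>, with \<open>F\<close> acting through the constant polynomials.\<close>

definition R_space :: "nat \<Rightarrow> nat \<Rightarrow> ('a::field, 'a poly poly set) module" where
  "R_space s l = ring.extend (R_ring s l)
     (module.fields (\<lambda>c v. R_class s l [:[:c:]:] \<otimes>\<^bsub>R_ring s l\<^esub> v))"

abbreviation ideal_space ::
  "nat \<Rightarrow> nat \<Rightarrow> 'a::field poly poly set set \<Rightarrow> ('a, 'a poly poly set) module" where
  "ideal_space s l I \<equiv> R_space s l\<lparr>carrier := I\<rparr>"

text \<open>
  The library notion \<open>vectorspace.basis\<close> is available only for records that satisfy the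
  \<open>vectorspace\<close> locale; the remaining lemmas establish this for every ideal of \<open>R\<close>.
\<close>

lemma R_modulus_ideal: "ideal (R_modulus s l) (ring_of_type_algebra :: 'a::field poly poly ring)"
proof -
  interpret P: cring "ring_of_type_algebra :: 'a poly poly ring"
    by (rule cring_from_type_algebra)
  show ?thesis unfolding R_modulus_def
    by (rule P.genideal_ideal) (simp add: ring_of_type_algebra_def)
qed

lemma cring_R_ring: "cring (R_ring s l :: 'a::field poly poly set ring)"
  unfolding R_ring_def
  by (intro ideal.quotient_is_cring R_modulus_ideal cring_from_type_algebra)

lemma R_class_hom:
  "R_class s l \<in> ring_hom (ring_of_type_algebra :: 'a::field poly poly ring) (R_ring s l)"
  using ideal.rcos_ring_hom[OF R_modulus_ideal, of s l]
  unfolding R_ring_def R_class_def by simp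

lemma vectorspace_ideal_space:
  fixes I :: "'a::field poly poly set set"
  assumes "ideal I (R_ring s l)"
  shows "vectorspace (ring_of_type_algebra :: 'a ring) (ideal_space s l I)"
proof -
  let ?F = "ring_of_type_algebra :: 'a ring"
  let ?R = "R_ring s l :: 'a poly poly set ring"
  let ?V = "ideal_space s l I"
  interpret R: cring ?R by (rule cring_R_ring)
  interpret I: ideal I ?R by (rule assms)
  interpret F: field ?F by (rule field_from_type_algebra)
  have V_simps: "carrier ?V = I" "add ?V = add ?R" "zero ?V = zero ?R"
    "module.smult (R_space s l) c v = R_class s l [:[:c:]:] \<otimes>\<^bsub>?R\<^esub> v" for c v
    by (simp_all add: R_space_def ring.defs module.defs)
  have in_R: "v \<in> carrier ?R" if "v \<in> I" for v
    using that by (rule I.Icarr)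
  have closed: "R_class s l h \<in> carrier ?R" for h :: "'a poly poly"
    using ring_hom_closed[OF R_class_hom] by (simp add: ring_of_type_algebra_def)
  have hom_add: "R_class s l (h + k) = R_class s l h \<oplus>\<^bsub>?R\<^esub> R_class s l k" for h k :: "'a poly poly"
    using ring_hom_add[OF R_class_hom] by (simp add: ring_of_type_algebra_def)
  have hom_mult: "R_class s l (h * k) = R_class s l h \<otimes>\<^bsub>?R\<^esub> R_class s l k" for h k :: "'a poly poly"
    using ring_hom_mult[OF R_class_hom] by (simp add: ring_of_type_algebra_def)
  have hom_one: "R_class s l (1 :: 'a poly poly) = \<one>\<^bsub>?R\<^esub>"
    using ring_hom_one[OF R_class_hom] by (simp add: ring_of_type_algebra_def)
  have const_add: "R_class s l [:[:a + b:]:] = R_class s l [:[:a:]:] \<oplus>\<^bsub>?R\<^esub> R_class s l [:[:b:]:]"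
    and const_mult: "R_class s l [:[:a * b:]:] = R_class s l [:[:a:]:] \<otimes>\<^bsub>?R\<^esub> R_class s l [:[:b:]:]"
    and const_one: "R_class s l [:[:1:]:] = \<one>\<^bsub>?R\<^esub>" for a b :: 'a
    using hom_add[of "[:[:a:]:]" "[:[:b:]:]"] hom_mult[of "[:[:a:]:]" "[:[:b:]:]"] hom_one
    by (simp_all add: one_pCons)
  have "abelian_group ?V"
  proof (rule abelian_groupI)
    fix v assume "v \<in> carrier ?V"
    then show "\<exists>w\<in>carrier ?V. w \<oplus>\<^bsub>?V\<^esub> v = \<zero>\<^bsub>?V\<^esub>"
      by (intro bexI[of _ "\<ominus>\<^bsub>?R\<^esub> v"]) (auto simp: V_simps in_R R.l_neg)
  qed (auto simp: V_simps in_R R.a_ac)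
  moreover have "module_axioms ?F ?V"
    by unfold_locales
      (simp_all add: V_simps in_R closed I.I_l_closed ring_of_type_algebra_def R.r_distr R.l_distr
        R.m_assoc const_add const_mult const_one)
  ultimately show ?thesis
    by (simp add: vectorspace_def module_def F.field_axioms F.is_cring)
qed

end

theory Submission
  imports Defs
begin

text \<open>
  An element of \<open>I\<close> without terms of \<open>y\<close>-degree below \<open>j\<close> has a \<open>y\<^sup>j\<close>-coefficient in
  \<open>I\<^sub>j = \<langle>p\<^sub>j\<rangle>\<close>. Writing \<open>x\<^sup>s - 1 = p\<^sub>j t\<close>, the cofactor of \<open>p\<^sub>j\<close> in this coefficient matters only
  modulo \<open>t\<close>, so that a unique multiple \<open>r P\<^sub>j\<close> with \<open>deg r < deg t = s - deg p\<^sub>j\<close> removes the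
  \<open>y\<^sup>j\<close>-term. Repeating this for \<open>j + 1, j + 2, \<dots>\<close> gives spanning. Independence follows by reading
  off the coefficients of \<open>y\<^sup>0, y\<^sup>1, \<dots>\<close> successively: \<open>x\<^sup>s - 1\<close> cannot divide \<open>r p\<^sub>j \<noteq> 0\<close>, which has
  degree below \<open>s\<close>.
\<close>

section \<open>The quotient rings\<close>

text \<open>Makes equality in \<open>S\<close> a question of divisibility by
  \<open>x^s - 1\<close>.\<close>

lemma Idl_singleton_type_algebra:
  "Idl\<^bsub>ring_of_type_algebra\<^esub> {u :: 'a::comm_ring_1} = {h. u dvd h}"
proof -
  interpret cring "ring_of_type_algebra :: 'a ring"
    by (rule cring_from_type_algebra)
  have "Idl\<^bsub>ring_of_type_algebra\<^esub> {u} = PIdl\<^bsub>ring_of_type_algebra\<^esub> u"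
    by (rule cgenideal_eq_genideal[symmetric]) (simp add: ring_of_type_algebra_def)
  then show ?thesis
    by (auto simp: cgenideal_def ring_of_type_algebra_def dvd_def mult.commute)
qed

text \<open>The combinations form an ideal containing both generators, so minimality of the
  generated ideal gives one inclusion; its closure properties give the other. This explicit form is
  what makes membership in \<open>R_modulus\<close> computable.\<close>

lemma Idl_pair_type_algebra:
  "Idl\<^bsub>ring_of_type_algebra\<^esub> {u, v :: 'a::comm_ring_1} = {a * u + b * v | a b. True}"
proof -
  let ?T = "ring_of_type_algebra :: 'a ring"
  let ?K = "{a * u + b * v | a b. True}"
  interpret T: cring ?T
    by (rule cring_from_type_algebra)
  have T_simps: "carrier ?T = UNIV" "add ?T = (+)" "monoid.mult ?T = (*)" "\<zero>\<^bsub>?T\<^esub> = 0"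
    by (simp_all add: ring_of_type_algebra_def)
  have minus: "\<ominus>\<^bsub>?T\<^esub> h = - h" for h
    using T.minus_equality[of "- h" h] by (simp add: T_simps)
  have ideal: "ideal ?K ?T"
  proof (rule idealI[OF T.ring_axioms])
    show "subgroup ?K (add_monoid ?T)"
    proof (rule T.add.subgroupI)
      show "?K \<noteq> {}" by auto
    next
      fix g h assume "g \<in> ?K" "h \<in> ?K"
      then obtain a b c d where "g = a * u + b * v" "h = c * u + d * v" by auto
      then have "g + h = (a + c) * u + (b + d) * v" by (simp add: algebra_simps)
      then show "g \<oplus>\<^bsub>?T\<^esub> h \<in> ?K" unfolding T_simps by blast
    next
      fix g assume "g \<in> ?K"
      then obtain a b where "g = a * u + b * v" by auto
      then have "- g = (- a) * u + (- b) * v" by (simp add: algebra_simps)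
      then show "\<ominus>\<^bsub>?T\<^esub> g \<in> ?K" unfolding minus by blast
    qed (simp_all add: T_simps)
  next
    fix g x assume "g \<in> ?K"
    then obtain a b where "g = a * u + b * v" by auto
    then have "x * g = (x * a) * u + (x * b) * v" "g * x = (x * a) * u + (x * b) * v"
      by (simp_all add: algebra_simps)
    then show "x \<otimes>\<^bsub>?T\<^esub> g \<in> ?K" "g \<otimes>\<^bsub>?T\<^esub> x \<in> ?K" unfolding T_simps by blast+
  qed
  show ?thesis
  proof
    have "u = 1 * u + 0 * v" "v = 0 * u + 1 * v" by simp_all
    then have "u \<in> ?K" "v \<in> ?K" by blast+
    then show "Idl\<^bsub>?T\<^esub> {u, v} \<subseteq> ?K"
      by (intro T.genideal_minimal ideal) auto
  next
    interpret J: ideal "Idl\<^bsub>?T\<^esub> {u, v}" ?T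
      by (rule T.genideal_ideal) (simp add: T_simps)
    have "{u, v} \<subseteq> Idl\<^bsub>?T\<^esub> {u, v}"
      by (rule T.genideal_self) (simp add: T_simps)
    then have "a * u + b * v \<in> Idl\<^bsub>?T\<^esub> {u, v}" for a b
      using J.I_l_closed[of u a] J.I_l_closed[of v b] J.a_closed[of "a * u" "b * v"]
      by (simp add: T_simps)
    then show "?K \<subseteq> Idl\<^bsub>?T\<^esub> {u, v}" by auto
  qed
qed

lemma a_r_coset_type_algebra_eq_iff:
  assumes "ideal K (ring_of_type_algebra :: 'a::comm_ring_1 ring)"
  shows "K +>\<^bsub>ring_of_type_algebra\<^esub> g = K +>\<^bsub>ring_of_type_algebra\<^esub> h \<longleftrightarrow> g - h \<in> K"
proof -
  let ?T = "ring_of_type_algebra :: 'a ring"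
  interpret T: cring ?T
    by (rule cring_from_type_algebra)
  have "\<ominus>\<^bsub>?T\<^esub> h = - h"
    using T.minus_equality[of "- h" h] by (simp add: ring_of_type_algebra_def)
  then have "g \<ominus>\<^bsub>?T\<^esub> h = g - h"
    by (simp add: a_minus_def) (simp add: ring_of_type_algebra_def)
  then show ?thesis
    using T.quotient_eq_iff_same_a_r_cos[OF assms, of g h] by (simp add: ring_of_type_algebra_def)
qed

lemma S_class_eq_iff:
  "S_class s g = S_class s h \<longleftrightarrow> (monom 1 s - 1 :: 'a::field poly) dvd g - h"
proof -
  interpret cring "ring_of_type_algebra :: 'a poly ring"
    by (rule cring_from_type_algebra)
  have "ideal (S_modulus s) (ring_of_type_algebra :: 'a poly ring)"
    unfolding S_modulus_def by (rule genideal_ideal) (simp add: ring_of_type_algebra_def)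
  from a_r_coset_type_algebra_eq_iff[OF this, of g h] show ?thesis
    by (simp add: S_class_def S_modulus_def Idl_singleton_type_algebra)
qed

text \<open>Every element of \<open>S\<close> is a class and the quotient map is multiplicative, so
  the multiples of the class of \<open>p\<close> come from multiples of \<open>p\<close> in
  \<open>F[x]\<close>.\<close>

lemma PIdl_S_class:
  "PIdl\<^bsub>S_ring s\<^esub> (S_class s p) = {S_class s (a * p) | a :: 'a::field poly. True}"
proof -
  let ?T = "ring_of_type_algebra :: 'a poly ring"
  interpret cring ?T
    by (rule cring_from_type_algebra)
  have "ideal (S_modulus s) ?T"
    unfolding S_modulus_def by (rule genideal_ideal) (simp add: ring_of_type_algebra_def)
  then have "S_class s \<in> ring_hom ?T (S_ring s)"
    using ideal.rcos_ring_hom unfolding S_ring_def S_class_def by blast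
  then have mult: "S_class s a \<otimes>\<^bsub>S_ring s\<^esub> S_class s p = S_class s (a * p)" for a
    using ring_hom_mult[of "S_class s" ?T "S_ring s" a p] by (simp add: ring_of_type_algebra_def)
  have "carrier (S_ring s) = range (S_class s :: 'a poly \<Rightarrow> _)"
    by (auto simp: S_ring_def S_class_def FactRing_def A_RCOSETS_def' ring_of_type_algebra_def)
  then show ?thesis
    by (auto simp: cgenideal_def mult[symmetric])
qed

lemma R_class_eq_iff: "R_class s l g = R_class s l h \<longleftrightarrow> g - h \<in> R_modulus s l"
  unfolding R_class_def by (rule a_r_coset_type_algebra_eq_iff[OF R_modulus_ideal])

lemma R_modulus_eq:
  "R_modulus s l = {a * [:monom 1 s - 1:] + b * (monom 1 l - 1) | a b :: 'a::field poly poly. True}"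
  unfolding R_modulus_def by (rule Idl_pair_type_algebra)

lemma R_class_simps:
  fixes g h :: "'a::field poly poly"
  shows R_class_add: "R_class s l (g + h) = R_class s l g \<oplus>\<^bsub>R_ring s l\<^esub> R_class s l h"
    and R_class_mult: "R_class s l (g * h) = R_class s l g \<otimes>\<^bsub>R_ring s l\<^esub> R_class s l h"
    and R_class_zero: "R_class s l (0 :: 'a poly poly) = \<zero>\<^bsub>R_ring s l\<^esub>"
    and carrier_R_ring: "carrier (R_ring s l) = range (R_class s l :: 'a poly poly \<Rightarrow> _)"
proof -
  let ?T = "ring_of_type_algebra :: 'a poly poly ring"
  interpret T: cring ?T by (rule cring_from_type_algebra)
  interpret R: cring "R_ring s l :: 'a poly poly set ring" by (rule cring_R_ring)
  interpret ring_hom_ring ?T "R_ring s l" "R_class s l"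
    by (intro ring_hom_ringI2 T.ring_axioms R.ring_axioms R_class_hom)
  show "R_class s l (g + h) = R_class s l g \<oplus>\<^bsub>R_ring s l\<^esub> R_class s l h"
    and "R_class s l (g * h) = R_class s l g \<otimes>\<^bsub>R_ring s l\<^esub> R_class s l h"
    and "R_class s l (0 :: 'a poly poly) = \<zero>\<^bsub>R_ring s l\<^esub>"
    using hom_add[of g h] hom_mult[of g h] hom_zero by (simp_all add: ring_of_type_algebra_def)
  show "carrier (R_ring s l) = range (R_class s l :: 'a poly poly \<Rightarrow> _)"
    by (auto simp: R_ring_def R_class_def FactRing_def A_RCOSETS_def' ring_of_type_algebra_def)
qed

section \<open>Reduced representatives\<close>

text \<open>For \<open>n = 0\<close> the polynomial vanishes, and its leading coefficient would be 0
  instead of 1.\<close>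

lemma monom_minus_one_degree:
  assumes "n \<ge> 1"
  shows "degree (monom 1 n - 1 :: 'a::comm_ring_1 poly) = n"
    and "lead_coeff (monom 1 n - 1 :: 'a poly) = 1"
proof -
  have "degree (monom 1 n - 1 :: 'a poly) \<le> n"
    by (intro degree_diff_le) (auto simp: degree_monom_le)
  moreover have "coeff (monom 1 n - 1 :: 'a poly) n = 1"
    using assms by (simp add: coeff_1)
  ultimately show "degree (monom 1 n - 1 :: 'a poly) = n" "lead_coeff (monom 1 n - 1 :: 'a poly) = 1"
    by (metis le_antisym le_degree one_neq_zero)+
qed

text \<open>Brings a polynomial into the shape required by \<open>R_expansion\<close>, with
  \<open>coeff h\<close> as the family of coefficients.\<close>

lemma poly_eq_sum_monom_coeff:
  assumes "\<And>i. i < j \<or> l \<le> i \<Longrightarrow> coeff h i = 0"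
  shows "h = (\<Sum>i=j..<l. monom (coeff h i) i)"
  using assms by (auto simp: poly_eq_iff coeff_sum if_distrib cong: if_cong)

text \<open>This is the uniqueness of the expansion in powers of \<open>y\<close> over
  \<open>S\<close>. If \<open>h = a (x^s - 1) + b (y^l - 1)\<close> has no terms from
  \<open>y^l\<close> on, then comparing coefficients there shows that the coefficients of
  \<open>b\<close> at \<open>n\<close> and \<open>n + l\<close> agree modulo \<open>x^s - 1\<close>.
  Those far out are 0, so \<open>x^s - 1\<close> divides all of \<open>b\<close>, hence all of
  \<open>h\<close>.\<close>

lemma reduced_in_R_modulus_iff:
  fixes h :: "'a::field poly poly"
  assumes "l \<ge> 1" and reduced: "\<And>i. l \<le> i \<Longrightarrow> coeff h i = 0"
  shows "h \<in> R_modulus s l \<longleftrightarrow> [:monom 1 s - 1:] dvd h"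
proof
  let ?X = "monom 1 s - 1 :: 'a poly"
  assume "h \<in> R_modulus s l"
  then obtain a b where h: "h = a * [:?X:] + b * (monom 1 l - 1)"
    unfolding R_modulus_eq by auto
  have coeff_h: "coeff h n = ?X * coeff a n + ((if n < l then 0 else coeff b (n - l)) - coeff b n)" for n
    by (simp add: h right_diff_distrib coeff_monom_mult mult.commute[of b] mult.commute[of a])
  have step: "?X dvd coeff b n" if "?X dvd coeff b (n + l)" for n
  proof -
    have "coeff b n = coeff b (n + l) - ?X * coeff a (n + l)"
      using coeff_h[of "n + l"] reduced[of "n + l"] by (simp add: algebra_simps)
    with that show ?thesis by auto
  qed
  have "?X dvd coeff b n" if "?X dvd coeff b (n + k * l)" for n k
    using that
  proof (induction k)
    case (Suc k)
    then show ?case using step[of "n + k * l"] by (simp add: ac_simps)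
  qed simp
  \<comment> \<open>Since \<open>l \<ge> 1\<close>, this many steps of length \<open>l\<close> pass
    the degree of \<open>b\<close> from any start, even \<open>n = 0\<close>.\<close>
  moreover have "coeff b (n + Suc (degree b) * l) = 0" for n
    using \<open>l \<ge> 1\<close> by (intro coeff_eq_0) (cases l; simp)
  ultimately have "?X dvd coeff b n" for n
    by (metis dvd_0_right)
  then have "?X dvd coeff h n" for n
    unfolding coeff_h by (intro dvd_add dvd_diff dvd_triv_left) auto
  then show "[:?X:] dvd h" by (simp add: const_poly_dvd_iff)
next
  assume "[:monom 1 s - 1:] dvd h"
  then obtain a where "h = a * [:monom 1 s - 1:] + 0 * (monom 1 l - 1)"
    by (auto simp: dvd_def mult.commute)
  then show "h \<in> R_modulus s l" unfolding R_modulus_eq by blast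
qed

lemma R_class_reduced_representative:
  fixes h :: "'a::field poly poly"
  assumes "l \<ge> 1"
  obtains r where "R_class s l r = R_class s l h" "\<And>i. l \<le> i \<Longrightarrow> coeff r i = 0"
proof -
  let ?Y = "monom 1 l - 1 :: 'a poly poly"
  \<comment> \<open>The coefficient ring \<open>F[x]\<close> is not a field, hence pseudo-division;
    as \<open>y^l - 1\<close> is monic, the scaling factor is 1 and this is ordinary division with
    remainder.\<close>
  obtain q r where qr: "pseudo_divmod h ?Y = (q, r)" by fastforce
  have Y: "?Y \<noteq> 0" "degree ?Y = l" "coeff ?Y l = 1"
    using monom_minus_one_degree[OF assms, where 'a = "'a poly"] assms by auto
  have "h = ?Y * q + r" and deg: "r = 0 \<or> degree r < l"
    using pseudo_divmod[OF Y(1) qr] unfolding Y by simp_all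
  then have "r - h = 0 * [:monom 1 s - 1:] + (- q) * ?Y" by (simp add: algebra_simps)
  then have "R_class s l r = R_class s l h"
    unfolding R_class_eq_iff R_modulus_eq by blast
  moreover have "coeff r i = 0" if "l \<le> i" for i
    using deg that by (auto intro: coeff_eq_0)
  ultimately show ?thesis using that by blast
qed

section \<open>Triangular systems\<close>

text \<open>Strong induction on \<open>j\<close>: in the coefficient of \<open>y^j\<close> the terms
  with smaller index vanish by induction, and those with larger index start above
  \<open>y^j\<close>. Only \<open>r j\<close> times the diagonal entry remains.\<close>

lemma triangular_independent:
  fixes Q :: "nat \<Rightarrow> 'a::field poly poly"
  assumes "s \<ge> 1"
    and p: "\<And>j. j < l \<Longrightarrow> p j \<noteq> 0 \<and> degree (p j) \<le> s"
    and low: "\<And>j i. j < l \<Longrightarrow> i < j \<Longrightarrow> coeff (Q j) i = 0"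
    and diag: "\<And>j. j < l \<Longrightarrow> monom 1 s - 1 dvd coeff (Q j) j - p j"
    and r: "\<And>j k. j < l \<Longrightarrow> s - degree (p j) \<le> k \<Longrightarrow> coeff (r j) k = 0"
    and dvd: "[:monom 1 s - 1:] dvd (\<Sum>j<l. [:r j:] * Q j)"
    and "j < l"
  shows "r j = 0"
  using \<open>j < l\<close>
proof (induction j rule: less_induct)
  case (less j)
  let ?X = "monom 1 s - 1 :: 'a poly"
  have "coeff (\<Sum>i<l. [:r i:] * Q i) j = (\<Sum>i<l. r i * coeff (Q i) j)"
    by (simp add: coeff_sum)
  also have "\<dots> = (\<Sum>i<l. if i = j then r j * coeff (Q j) j else 0)"
  proof (intro sum.cong refl)
    fix i assume "i \<in> {..<l}"
    then show "r i * coeff (Q i) j = (if i = j then r j * coeff (Q j) j else 0)"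
      using less.IH[of i] low[of i j] by (cases i j rule: linorder_cases) auto
  qed
  also have "\<dots> = r j * coeff (Q j) j"
    using less.prems by simp
  finally have "?X dvd r j * coeff (Q j) j"
    using dvd by (metis const_poly_dvd_iff)
  \<comment> \<open>The diagonal entry is known only modulo \<open>x^s - 1\<close>; subtracting this
    multiple replaces it by \<open>p j\<close> itself, whose degree is under control.\<close>
  then have "?X dvd r j * coeff (Q j) j - r j * (coeff (Q j) j - p j)"
    by (rule dvd_diff[OF _ dvd_mult[OF diag[OF less.prems]]])
  then have dvd_rp: "?X dvd r j * p j"
    by (simp add: algebra_simps)
  show "r j = 0"
  proof (rule ccontr)
    assume "r j \<noteq> 0"
    then have "degree (r j) < s - degree (p j)"
      using r[OF less.prems] by (metis leading_coeff_0_iff not_le)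
    moreover have "degree (r j * p j) = degree (r j) + degree (p j)"
      using \<open>r j \<noteq> 0\<close> p[OF less.prems] by (simp add: degree_mult_eq)
    ultimately have "degree (r j * p j) < degree ?X"
      using monom_minus_one_degree(1)[OF \<open>s \<ge> 1\<close>, where 'a = 'a] by simp
    then have "r j * p j = 0"
      using dvd_rp by (meson dvd_imp_degree_le not_le)
    then show False
      using \<open>r j \<noteq> 0\<close> p[OF less.prems] by simp
  qed
qed

text \<open>\<open>J\<close> stands for the preimage of \<open>I\<close> in \<open>F[x,y]\<close>.
  The induction descends from \<open>j = l\<close>, where \<open>h\<close> is 0: a multiple of
  \<open>Q j\<close> clears the \<open>y^j\<close> term up to a multiple of \<open>x^s - 1\<close>,
  and the rest starts at \<open>y^(j+1)\<close>.\<close>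

lemma triangular_spanning:
  fixes Q :: "nat \<Rightarrow> 'a::field poly poly" and J :: "'a poly poly set"
  assumes "s \<ge> 1"
    and J_diff: "\<And>g h. g \<in> J \<Longrightarrow> h \<in> J \<Longrightarrow> g - h \<in> J"
    and J_mult: "\<And>f h. h \<in> J \<Longrightarrow> f * h \<in> J"
    and J_modulus: "[:monom 1 s - 1:] \<in> J"
    and p: "\<And>j. j < l \<Longrightarrow> p j dvd monom 1 s - 1"
    and lead: "\<And>j h. j < l \<Longrightarrow> h \<in> J \<Longrightarrow> (\<And>i. i < j \<or> l \<le> i \<Longrightarrow> coeff h i = 0) \<Longrightarrow> p j dvd coeff h j"
    and Q_J: "\<And>j. j < l \<Longrightarrow> Q j \<in> J"
    and supp: "\<And>j i. j < l \<Longrightarrow> i < j \<or> l \<le> i \<Longrightarrow> coeff (Q j) i = 0"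
    and diag: "\<And>j. j < l \<Longrightarrow> monom 1 s - 1 dvd coeff (Q j) j - p j"
    and "j \<le> l" and "h \<in> J" and "\<And>i. i < j \<or> l \<le> i \<Longrightarrow> coeff h i = 0"
  shows "\<exists>r. (\<forall>j<l. \<forall>k\<ge>s - degree (p j). coeff (r j) k = 0) \<and>
    [:monom 1 s - 1:] dvd h - (\<Sum>j<l. [:r j:] * Q j)"
  using \<open>j \<le> l\<close> assms(11,12)
proof (induction arbitrary: h rule: inc_induct)
  case base
  then have "h = 0" by (intro poly_eqI) (metis coeff_0 not_le)
  then show ?case by (intro exI[of _ "\<lambda>_. 0"]) simp
next
  case (step j)
  let ?X = "monom 1 s - 1 :: 'a poly"
  have X: "?X \<noteq> 0" "degree ?X = s"
    using monom_minus_one_degree[OF \<open>s \<ge> 1\<close>, where 'a = 'a] by auto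
  obtain t where t: "?X = p j * t"
    using p[OF \<open>j < l\<close>] by (auto simp: dvd_def)
  obtain b where b: "coeff h j = p j * b"
    using lead[OF \<open>j < l\<close>, of h] step.prems by (auto simp: dvd_def)
  have nz: "p j \<noteq> 0" "t \<noteq> 0"
    using X(1) t by auto
  then have deg_t: "degree t = s - degree (p j)"
    using X(2) t by (simp add: degree_mult_eq)
  \<comment> \<open>As \<open>p j * t = x^s - 1\<close>, reducing \<open>b\<close> modulo
    \<open>t\<close> changes \<open>p j * b\<close> only by a multiple of \<open>x^s - 1\<close>,
    and it enforces the degree bound.\<close>
  define r0 where "r0 = b mod t"
  have r0: "coeff r0 k = 0" if "s - degree (p j) \<le> k" for k
    using that degree_mod_less[OF nz(2), of b] deg_t unfolding r0_def
    by (metis coeff_0 coeff_eq_0 less_le_trans)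
  define h1 where "h1 = h - [:r0:] * Q j"
  have "coeff h1 j = p j * b - r0 * coeff (Q j) j"
    by (simp add: h1_def b)
  also have "\<dots> = ?X * (b div t) - r0 * (coeff (Q j) j - p j)"
  proof -
    have "p j * b = p j * (t * (b div t) + r0)"
      unfolding r0_def by simp
    then show ?thesis unfolding t by (simp add: algebra_simps)
  qed
  finally have dvd_h1: "?X dvd coeff h1 j"
    using diag[OF \<open>j < l\<close>] by auto
  \<comment> \<open>The \<open>y^j\<close> coefficient of \<open>h1\<close> is divisible by
    \<open>x^s - 1\<close> but may be nonzero. The induction hypothesis wants it to be 0, so the
    monomial, itself in \<open>J\<close>, is removed and restored at the end.\<close>
  define h2 where "h2 = h1 - monom (coeff h1 j) j"
  have dvd_monom: "[:?X:] dvd monom (coeff h1 j) j"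
    using dvd_h1 by (auto simp: const_poly_dvd_iff)
  then have "monom (coeff h1 j) j \<in> J"
    using J_mult[OF J_modulus] by (auto simp: dvd_def mult.commute)
  then have "h2 \<in> J"
    unfolding h2_def h1_def using step.prems(1) Q_J[OF \<open>j < l\<close>] by (intro J_diff J_mult)
  moreover have "coeff h2 i = 0" if "i < Suc j \<or> l \<le> i" for i
    using that step.prems(2)[of i] supp[OF \<open>j < l\<close>, of i] \<open>j < l\<close>
    by (auto simp: h2_def h1_def less_Suc_eq)
  ultimately obtain r where r: "\<forall>j<l. \<forall>k\<ge>s - degree (p j). coeff (r j) k = 0"
    and dvd: "[:?X:] dvd h2 - (\<Sum>j<l. [:r j:] * Q j)"
    using step.IH by blast
  \<comment> \<open>The induction hypothesis does not say that \<open>r j\<close> is 0, so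
    \<open>r0\<close> is added to it; the degree bound survives the addition.\<close>
  define r' where "r' i = r i + (if i = j then r0 else 0)" for i
  have "[:r' i:] * Q i = [:r i:] * Q i + (if i = j then [:r0:] * Q j else 0)" for i
    by (simp add: r'_def smult_add_left)
  then have "(\<Sum>i<l. [:r' i:] * Q i) = (\<Sum>i<l. [:r i:] * Q i) + [:r0:] * Q j"
    using \<open>j < l\<close> by (simp add: sum.distrib)
  then have "h - (\<Sum>i<l. [:r' i:] * Q i)
      = (h2 - (\<Sum>i<l. [:r i:] * Q i)) + monom (coeff h1 j) j"
    by (simp add: h2_def h1_def)
  then have "[:?X:] dvd h - (\<Sum>i<l. [:r' i:] * Q i)"
    using dvd_add[OF dvd dvd_monom] by (simp only:)
  moreover have "\<forall>j<l. \<forall>k\<ge>s - degree (p j). coeff (r' j) k = 0"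
    using r r0 by (auto simp: r'_def)
  ultimately show ?case by blast
qed

section \<open>Bases\<close>

lemma (in vectorspace) basis_imageI:
  assumes "finite A" and f: "f \<in> A \<rightarrow> carrier V"
    and spanning: "\<And>v. v \<in> carrier V \<Longrightarrow> \<exists>c\<in>A \<rightarrow> carrier K. v = (\<Oplus>\<^bsub>V\<^esub>i\<in>A. c i \<odot>\<^bsub>V\<^esub> f i)"
    and unique: "\<And>c d i. c \<in> A \<rightarrow> carrier K \<Longrightarrow> d \<in> A \<rightarrow> carrier K \<Longrightarrow>
      (\<Oplus>\<^bsub>V\<^esub>i\<in>A. c i \<odot>\<^bsub>V\<^esub> f i) = (\<Oplus>\<^bsub>V\<^esub>i\<in>A. d i \<odot>\<^bsub>V\<^esub> f i) \<Longrightarrow> i \<in> A \<Longrightarrow> c i = d i"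
  shows "basis (f ` A)"
proof -
  have f_in: "f i \<in> carrier V" if "i \<in> A" for i
    using f that by auto
  have unit_sum: "(\<Oplus>\<^bsub>V\<^esub>i\<in>A. (if m = i then \<one>\<^bsub>K\<^esub> else \<zero>\<^bsub>K\<^esub>) \<odot>\<^bsub>V\<^esub> f i) = f m" if "m \<in> A" for m
  proof -
    have "(\<Oplus>\<^bsub>V\<^esub>i\<in>A. (if m = i then \<one>\<^bsub>K\<^esub> else \<zero>\<^bsub>K\<^esub>) \<odot>\<^bsub>V\<^esub> f i) = (\<Oplus>\<^bsub>V\<^esub>i\<in>A. if m = i then f i else \<zero>\<^bsub>V\<^esub>)"
      by (rule M.finsum_cong') (auto simp: f_in lmult_0)
    also have "\<dots> = f m"
      using M.finsum_singleton[OF that \<open>finite A\<close> f] .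
    finally show ?thesis .
  qed
  \<comment> \<open>If \<open>f m = f n\<close> with \<open>m\<close> and \<open>n\<close> distinct,
    the indicator families of \<open>m\<close> and \<open>n\<close> have the same sum, against
    uniqueness at \<open>m\<close>.\<close>
  have inj: "inj_on f A"
  proof (rule inj_onI, rule ccontr)
    fix m n assume *: "m \<in> A" "n \<in> A" "f m = f n" "m \<noteq> n"
    have "(if m = m then \<one>\<^bsub>K\<^esub> else \<zero>\<^bsub>K\<^esub>) = (if n = m then \<one>\<^bsub>K\<^esub> else \<zero>\<^bsub>K\<^esub>)"
      by (rule unique[of "\<lambda>i. if m = i then \<one>\<^bsub>K\<^esub> else \<zero>\<^bsub>K\<^esub>" "\<lambda>i. if n = i then \<one>\<^bsub>K\<^esub> else \<zero>\<^bsub>K\<^esub>"])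
        (use * unit_sum in auto)
    with * show False by simp
  qed
  have lincomb_image: "lincomb a (f ` A) = (\<Oplus>\<^bsub>V\<^esub>i\<in>A. a (f i) \<odot>\<^bsub>V\<^esub> f i)"
    if "a \<in> f ` A \<rightarrow> carrier K" for a
    unfolding lincomb_def using that f_in by (intro M.finsum_reindex[OF _ inj]) auto
  have sub: "f ` A \<subseteq> carrier V" using f by auto
  have fin: "finite (f ` A)" using \<open>finite A\<close> by simp
  have "lin_indpt (f ` A)"
  proof (rule finite_lin_indpt2[OF fin sub])
    fix a assume a: "a \<in> f ` A \<rightarrow> carrier K" and "lincomb a (f ` A) = \<zero>\<^bsub>V\<^esub>"
    then have "(\<Oplus>\<^bsub>V\<^esub>i\<in>A. a (f i) \<odot>\<^bsub>V\<^esub> f i) = \<zero>\<^bsub>V\<^esub>"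
      by (simp add: lincomb_image)
    also have "\<dots> = (\<Oplus>\<^bsub>V\<^esub>i\<in>A. \<zero>\<^bsub>K\<^esub> \<odot>\<^bsub>V\<^esub> f i)"
      by (rule sym) (simp add: M.finsum_zero lmult_0 f_in cong: M.finsum_cong')
    finally have "a (f i) = \<zero>\<^bsub>K\<^esub>" if "i \<in> A" for i
      using unique[of "\<lambda>i. a (f i)" "\<lambda>_. \<zero>\<^bsub>K\<^esub>" i] a that by auto
    then show "\<forall>v\<in>f ` A. a v = \<zero>\<^bsub>K\<^esub>" by auto
  qed
  moreover have "v \<in> span (f ` A)" if "v \<in> carrier V" for v
  proof -
    obtain c where c: "c \<in> A \<rightarrow> carrier K" "v = (\<Oplus>\<^bsub>V\<^esub>i\<in>A. c i \<odot>\<^bsub>V\<^esub> f i)"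
      using spanning \<open>v \<in> carrier V\<close> by blast
    \<comment> \<open>\<open>lincomb\<close> takes coefficients indexed by vectors, so
      \<open>c\<close> is carried along the inverse of \<open>f\<close>.\<close>
    define a where "a = c \<circ> the_inv_into A f"
    have af: "a (f i) = c i" if "i \<in> A" for i
      using that inj by (simp add: a_def the_inv_into_f_f)
    have a: "a \<in> f ` A \<rightarrow> carrier K"
      using c(1) af by auto
    have "v = lincomb a (f ` A)"
      unfolding lincomb_image[OF a] c(2)
      by (rule M.finsum_cong') (use c(1) af f_in in \<open>auto simp: Pi_iff\<close>)
    with a show ?thesis
      using finite_span[OF fin sub] by auto
  qed
  then have "gen_set (f ` A)"
    using span_is_subset2[OF sub] by auto
  ultimately show ?thesis
    using sub by (simp add: basis_def)
qed

text \<open>Moves sums of vectors into \<open>F[x,y]\<close>, where coefficients can be compared.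
  The space inherits its addition from \<open>R\<close>, and \<open>R_class\<close> is
  additive.\<close>

lemma ideal_space_finsum_R_class:
  fixes I :: "'a::field poly poly set set"
  assumes "ideal I (R_ring s l)" and "finite A" and "\<And>i. i \<in> A \<Longrightarrow> R_class s l (g i) \<in> I"
  shows "(\<Oplus>\<^bsub>ideal_space s l I\<^esub>i\<in>A. R_class s l (g i)) = R_class s l (\<Sum>i\<in>A. g i)"
proof -
  interpret vectorspace "ring_of_type_algebra :: 'a ring" "ideal_space s l I"
    by (rule vectorspace_ideal_space[OF assms(1)])
  have V: "carrier (ideal_space s l I) = I" "add (ideal_space s l I) = add (R_ring s l)"
    "zero (ideal_space s l I) = zero (R_ring s l)"
    by (simp_all add: R_space_def ring.defs module.defs)
  show ?thesis using assms(2,3)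
  proof (induction A rule: finite_induct)
    case empty
    then show ?case by (simp add: V R_class_zero)
  next
    case (insert i A)
    then have "(\<lambda>i. R_class s l (g i)) \<in> A \<rightarrow> carrier (ideal_space s l I)"
      "R_class s l (g i) \<in> carrier (ideal_space s l I)"
      by (auto simp: V)
    with insert show ?case
      by (simp add: M.finsum_insert V R_class_add)
  qed
qed

section \<open>The multiples \<open>x^k P_j\<close> as a basis of \<open>I\<close>\<close>

theorem theorem2p1:
  fixes s l :: nat
    and I :: "'a::{field,finite} poly poly set set"
    and p :: "nat \<Rightarrow> 'a poly"
    and P :: "nat \<Rightarrow> 'a poly poly set"
  assumes "s \<ge> 1" and "l \<ge> 1"
    and "ideal I (R_ring s l)"
    and "\<And>j. j < l \<Longrightarrow> is_monic_generator s (coeff_ideal s l I j) (p j)"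
    and "\<And>j. j < l \<Longrightarrow> P j \<in> I"
    and "\<And>j. j < l \<Longrightarrow> \<exists>q. P j = R_expansion s l j q \<and> S_class s (q j) = S_class s (p j)"
  shows "vectorspace.basis (ring_of_type_algebra :: 'a ring) (ideal_space s l I)
           {R_class s l [:monom 1 k:] \<otimes>\<^bsub>R_ring s l\<^esub> P j | j k. j < l \<and> k < s - degree (p j)}"
proof -
  let ?F = "ring_of_type_algebra :: 'a ring"
  let ?R = "R_ring s l :: 'a poly poly set ring"
  let ?V = "ideal_space s l I"
  let ?X = "monom 1 s - 1 :: 'a poly"
  define n where "n j = s - degree (p j)" for j
  interpret R: cring ?R by (rule cring_R_ring)
  interpret I: ideal I ?R by (rule assms(3))
  interpret V: vectorspace ?F ?V by (rule vectorspace_ideal_space[OF assms(3)])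
  have V_simps: "carrier ?V = I" "carrier ?F = UNIV"
    "c \<odot>\<^bsub>?V\<^esub> v = R_class s l [:[:c:]:] \<otimes>\<^bsub>?R\<^esub> v" for c v
    by (simp_all add: R_space_def ring.defs module.defs ring_of_type_algebra_def)
  \<comment> \<open>The preimage of \<open>I\<close> allows the triangular arguments to run on
    polynomials instead of cosets.\<close>
  define J where "J = {h. R_class s l h \<in> I}"
  have J_mult: "f * h \<in> J" if "h \<in> J" for f h
    using that I.I_l_closed by (simp add: J_def R_class_mult carrier_R_ring)
  have J_diff: "g - h \<in> J" if "g \<in> J" "h \<in> J" for g h
  proof -
    have "- h \<in> J"
      using J_mult[OF that(2), of "- 1"] by simp
    then have "R_class s l (g + - h) \<in> I"
      using that(1) I.a_closed unfolding R_class_add J_def by blast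
    then show ?thesis by (simp add: J_def)
  qed
  have R_class_J: "g \<in> J" if "R_class s l g = R_class s l h" "h \<in> J" for g h
    using that by (simp add: J_def)
  have "[:?X:] - 0 \<in> R_modulus s l"
  proof -
    have "[:?X:] - 0 = 1 * [:?X:] + 0 * (monom 1 l - 1)" by simp
    then show ?thesis unfolding R_modulus_eq by blast
  qed
  then have "R_class s l [:?X:] = \<zero>\<^bsub>?R\<^esub>"
    by (simp only: R_class_eq_iff[symmetric] R_class_zero)
  then have J_modulus: "[:?X:] \<in> J"
    by (simp add: J_def)

  have p: "p j dvd ?X" "p j \<noteq> 0" "degree (p j) \<le> s"
    and coeff_ideal: "coeff_ideal s l I j = PIdl\<^bsub>S_ring s\<^esub> (S_class s (p j))" if "j < l" for j
  proof -
    show "p j dvd ?X" "coeff_ideal s l I j = PIdl\<^bsub>S_ring s\<^esub> (S_class s (p j))"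
      using assms(4)[OF that] by (simp_all add: is_monic_generator_def)
    show "p j \<noteq> 0"
      using assms(4)[OF that] by (auto simp: is_monic_generator_def)
    have "?X \<noteq> 0" "degree ?X = s"
      using monom_minus_one_degree[OF assms(1), where 'a = 'a] assms(1) by auto
    then show "degree (p j) \<le> s"
      using dvd_imp_degree_le[OF \<open>p j dvd ?X\<close>] by simp
  qed
  \<comment> \<open>The class of this coefficient lies in the \<open>j\<close>-th coefficient ideal,
    so it is a multiple of \<open>p j\<close> modulo \<open>x^s - 1\<close>. Since
    \<open>p j\<close> divides \<open>x^s - 1\<close>, divisibility lifts from \<open>S\<close> to
    \<open>F[x]\<close>.\<close>
  have lead: "p j dvd coeff h j"
    if "j < l" "h \<in> J" "\<And>i. i < j \<or> l \<le> i \<Longrightarrow> coeff h i = 0" for j h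
  proof -
    have "R_expansion s l j (coeff h) \<in> I"
      using \<open>h \<in> J\<close> poly_eq_sum_monom_coeff[OF that(3)] by (simp add: R_expansion_def J_def)
    then have "S_class s (coeff h j) \<in> PIdl\<^bsub>S_ring s\<^esub> (S_class s (p j))"
      unfolding coeff_ideal[OF that(1), symmetric] coeff_ideal_def by blast
    then obtain a where "?X dvd coeff h j - a * p j"
      unfolding PIdl_S_class S_class_eq_iff[symmetric] by blast
    then have "p j dvd (coeff h j - a * p j) + a * p j"
      using p(1)[OF that(1)] by (intro dvd_add) (auto intro: dvd_trans)
    then show ?thesis by simp
  qed

  obtain q where q: "\<And>j. j < l \<Longrightarrow> P j = R_expansion s l j (q j)"
    "\<And>j. j < l \<Longrightarrow> S_class s (q j j) = S_class s (p j)"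
    using assms(6) by metis
  \<comment> \<open>A polynomial lift of \<open>P j\<close> with exact support condition; its
    diagonal entry agrees with \<open>p j\<close> only modulo \<open>x^s - 1\<close>.\<close>
  define Q where "Q j = (\<Sum>i=j..<l. monom (q j i) i)" for j
  have coeff_Q: "coeff (Q j) i = (if j \<le> i \<and> i < l then q j i else 0)" for i j
    by (simp add: Q_def coeff_sum)
  have P: "P j = R_class s l (Q j)" if "j < l" for j
    using q(1)[OF that] by (simp add: R_expansion_def Q_def)
  have Q_J: "Q j \<in> J" if "j < l" for j
    using assms(5)[OF that] P[OF that] by (simp add: J_def)
  have supp: "coeff (Q j) i = 0" if "i < j \<or> l \<le> i" for i j
    using that by (auto simp: coeff_Q)
  have diag: "?X dvd coeff (Q j) j - p j" if "j < l" for j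
    using q(2)[OF that] that by (simp add: S_class_eq_iff coeff_Q)

  define A where "A = (SIGMA j:{..<l}. {..<n j})"
  define f where "f = (\<lambda>(j, k). R_class s l [:monom 1 k:] \<otimes>\<^bsub>?R\<^esub> P j)"
  \<comment> \<open>The scalars belonging to one \<open>j\<close> are packed into a polynomial in
    \<open>x\<close> with no terms from \<open>x^(n j)\<close> on. Scalar families on
    \<open>A\<close> thus correspond to the multipliers with the degree bound of the triangular
    lemmas.\<close>
  define r where "r c j = (\<Sum>k<n j. monom (c (j, k)) k)" for c :: "nat \<times> nat \<Rightarrow> 'a" and j
  have coeff_r: "coeff (r c j) k = (if k < n j then c (j, k) else 0)" for c j k
    by (simp add: r_def coeff_sum)
  have f_eq: "f (j, k) = R_class s l ([:monom 1 k:] * Q j)" if "j < l" for j k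
    by (simp only: f_def P[OF that] R_class_mult prod.case)
  have f: "f \<in> A \<rightarrow> carrier ?V"
    using J_mult[OF Q_J] f_eq by (auto simp: A_def V_simps J_def simp del: mult_pCons_left)
  have combination: "(\<Oplus>\<^bsub>?V\<^esub>i\<in>A. c i \<odot>\<^bsub>?V\<^esub> f i) = R_class s l (\<Sum>j<l. [:r c j:] * Q j)" for c
  proof -
    define g where "g = (\<lambda>(j, k). [:monom (c (j, k)) k:] * Q j)"
    have g_J: "R_class s l (g i) \<in> I" if "i \<in> A" for i
      using that J_mult[OF Q_J] by (auto simp: A_def g_def J_def simp del: mult_pCons_left)
    have smult: "c i \<odot>\<^bsub>?V\<^esub> f i = R_class s l (g i)" if "i \<in> A" for i
    proof -
      obtain j k where i: "i = (j, k)" "j < l"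
        using \<open>i \<in> A\<close> by (auto simp: A_def)
      have "c i \<odot>\<^bsub>?V\<^esub> f i = R_class s l ([:[:c i:]:] * ([:monom 1 k:] * Q j))"
        unfolding i(1) f_eq[OF i(2)] by (simp only: R_class_mult V_simps)
      also have "[:[:c i:]:] * ([:monom 1 k:] * Q j) = g i"
        by (simp add: g_def i(1) smult_monom)
      finally show ?thesis .
    qed
    have "(\<Oplus>\<^bsub>?V\<^esub>i\<in>A. c i \<odot>\<^bsub>?V\<^esub> f i) = (\<Oplus>\<^bsub>?V\<^esub>i\<in>A. R_class s l (g i))"
      by (rule V.M.finsum_cong') (use smult g_J in \<open>auto simp: V_simps\<close>)
    also have "\<dots> = R_class s l (\<Sum>i\<in>A. g i)"
      by (rule ideal_space_finsum_R_class[OF assms(3)]) (use g_J in \<open>auto simp: A_def\<close>)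
    also have "(\<Sum>i\<in>A. g i) = (\<Sum>j<l. \<Sum>k<n j. [:monom (c (j, k)) k:] * Q j)"
      unfolding A_def g_def by (subst sum.Sigma) auto
    also have "\<dots> = (\<Sum>j<l. [:r c j:] * Q j)"
      by (simp add: r_def smult_sum)
    finally show ?thesis .
  qed

  have "V.basis (f ` A)"
  proof (rule V.basis_imageI[OF _ f])
    show "finite A" by (simp add: A_def)
  next
    fix v assume "v \<in> carrier ?V"
    then obtain h0 where h0: "v = R_class s l h0" "h0 \<in> J"
      using I.Icarr by (force simp: V_simps carrier_R_ring J_def)
    obtain h where h: "R_class s l h = R_class s l h0" "\<And>i. l \<le> i \<Longrightarrow> coeff h i = 0"
      using R_class_reduced_representative[OF assms(2)] by blast
    have "\<exists>t. (\<forall>j<l. \<forall>k\<ge>s - degree (p j). coeff (t j) k = 0) \<and>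
      [:?X:] dvd h - (\<Sum>j<l. [:t j:] * Q j)"
    \<comment> \<open>At \<open>j = 0\<close> the support condition says just that \<open>h\<close>
      is reduced, which the choice of representative provides.\<close>
    proof (rule triangular_spanning[where J = J and j = 0])
      show "h \<in> J"
        using h(1) h0(2) by (rule R_class_J)
      show "coeff h i = 0" if "i < 0 \<or> l \<le> i" for i
        using that h(2) by simp
      show "coeff (Q j) i = 0" if "i < j \<or> l \<le> i" for i j
        using that by (rule supp)
    qed (fact assms(1) J_diff J_mult J_modulus p(1) lead Q_J diag le0)+
    then obtain t where t: "\<forall>j<l. \<forall>k\<ge>s - degree (p j). coeff (t j) k = 0"
      and dvd: "[:?X:] dvd h - (\<Sum>j<l. [:t j:] * Q j)"
      by blast
    define c where "c = (\<lambda>(j, k). coeff (t j) k)"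
    have "r c j = t j" if "j < l" for j
      using that t by (auto simp: poly_eq_iff coeff_r c_def n_def)
    then have sum_eq: "(\<Sum>j<l. [:r c j:] * Q j) = (\<Sum>j<l. [:t j:] * Q j)"
      by simp
    have "h - (\<Sum>j<l. [:t j:] * Q j) \<in> R_modulus s l"
      using dvd by (subst reduced_in_R_modulus_iff[OF assms(2)]) (simp_all add: coeff_sum h(2) supp)
    then have "v = (\<Oplus>\<^bsub>?V\<^esub>i\<in>A. c i \<odot>\<^bsub>?V\<^esub> f i)"
      unfolding combination sum_eq h0(1) h(1)[symmetric] R_class_eq_iff .
    then show "\<exists>c\<in>A \<rightarrow> carrier ?F. v = (\<Oplus>\<^bsub>?V\<^esub>i\<in>A. c i \<odot>\<^bsub>?V\<^esub> f i)"
      by (intro bexI[of _ c]) (auto simp: V_simps)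
  next
    fix c d i
    assume "(\<Oplus>\<^bsub>?V\<^esub>i\<in>A. c i \<odot>\<^bsub>?V\<^esub> f i) = (\<Oplus>\<^bsub>?V\<^esub>i\<in>A. d i \<odot>\<^bsub>?V\<^esub> f i)" and "i \<in> A"
    then have "(\<Sum>j<l. [:r c j:] * Q j) - (\<Sum>j<l. [:r d j:] * Q j) \<in> R_modulus s l"
      unfolding combination R_class_eq_iff by simp
    also have "(\<Sum>j<l. [:r c j:] * Q j) - (\<Sum>j<l. [:r d j:] * Q j) = (\<Sum>j<l. [:r c j - r d j:] * Q j)"
      by (simp add: sum_subtractf smult_diff_left)
    \<comment> \<open>The multipliers are constant in \<open>y\<close>, so the sum is still reduced,
      and being 0 in \<open>R\<close> means divisibility by \<open>x^s - 1\<close>.\<close>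
    finally have dvd: "[:?X:] dvd (\<Sum>j<l. [:r c j - r d j:] * Q j)"
      by (subst (asm) reduced_in_R_modulus_iff[OF assms(2)]) (simp_all add: coeff_sum supp)
    have "r c j - r d j = 0" if "j < l" for j
    proof (rule triangular_independent[where r = "\<lambda>j. r c j - r d j" and p = p and Q = Q])
      show "p j \<noteq> 0 \<and> degree (p j) \<le> s" if "j < l" for j
        using p[OF that] by blast
      show "coeff (Q j) i = 0" if "i < j" for i j
        using supp that by blast
      show "coeff (r c j - r d j) k = 0" if "s - degree (p j) \<le> k" for j k
        using that by (simp add: coeff_r n_def)
    qed (fact assms(1) diag dvd that)+
    moreover obtain j k where "i = (j, k)" "j < l" "k < n j"
      using \<open>i \<in> A\<close> by (auto simp: A_def)
    ultimately show "c i = d i"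
      using coeff_r[of c j k] coeff_r[of d j k] by simp
  qed
  also have "f ` A = {R_class s l [:monom 1 k:] \<otimes>\<^bsub>?R\<^esub> P j | j k. j < l \<and> k < s - degree (p j)}"
    by (force simp: f_def A_def n_def image_def)
  finally show ?thesis .
qed

end
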